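(* Let $m\ge 2$ be an integer and let $\mathcal{A}\subset\mathbb{R}$ be a finite alphabet. Let $(X^{(j)}_i)_{i\ge 1,\,1\le j\le m}$ be independent and identically distributed random variables with values in $\mathcal{A}$. Let $S:\mathcal{A}^m\to[0,\infty)$ be a function that is not identically zero, is invariant under permutations of its $m$ arguments, satisfies $s^*:=\sup_{x\in\mathcal{A}^m}S(x)<\infty$, and for which there is a constant $D>0$ such that $|S(x)-S(y)|\le D$ whenever $x,y\in\mathcal{A}^m$ differ in at most one coordinate. Let $L_n$ be the optimal alignment score of the $m$ words $X^{(j)}_1X^{(j)}_2\cdots X^{(j)}_n$, $j=1,\dots,m$, and let $\gamma^*:=\lim_{n\to\infty}\mathbb{E}(L_n)/n=\sup_{n\ge1}\mathbb{E}(L_n)/n$. Then there is a constant $K>0$, independent of $n$, such that $$n\gamma^*-K\sqrt{n\ln n}\le \mathbb{E}(L_n)\le n\gamma^*\quad\text{for all integers } n\ge 2.$$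
   Context: Alignments and optimal score: for finite words $w^{(1)},\dots,w^{(m)}$ over $\mathcal{A}$ of lengths $\ell_1,\dots,\ell_m$, an alignment is a choice of an integer $k\ge 0$ and, for each $j$, indices $1\le \pi^{(j)}_1<\pi^{(j)}_2<\cdots<\pi^{(j)}_k\le \ell_j$; its score is $\sum_{i=1}^k S(w^{(1)}_{\pi^{(1)}_i},\dots,w^{(m)}_{\pi^{(m)}_i})$. The optimal score $L(w^{(1)};\dots;w^{(m)})$ is the maximum score over all alignments. The limit defining $\gamma^*$ exists and equals the supremum (by superadditivity). *)

theory Defs
  imports "HOL-Probability.Probability"
begin

definition is_alignment :: "'b list list \<Rightarrow> nat \<Rightarrow> (nat \<Rightarrow> nat \<Rightarrow> nat) \<Rightarrow> bool" where
  "is_alignment ws k \<pi> \<longleftrightarrow>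
     (\<forall>j < length ws. strict_mono_on {..<k} (\<pi> j) \<and> (\<forall>i < k. \<pi> j i < length (ws ! j)))"

definition alignment_score ::
    "('b list \<Rightarrow> real) \<Rightarrow> 'b list list \<Rightarrow> nat \<Rightarrow> (nat \<Rightarrow> nat \<Rightarrow> nat) \<Rightarrow> real" where
  "alignment_score S ws k \<pi> = (\<Sum>i<k. S (map (\<lambda>j. ws ! j ! \<pi> j i) [0..<length ws]))"

text \<open>Optimal score L(w^(1);...;w^(m)): the maximum score over all alignments
  (the set of attained scores is finite).\<close>

definition opt_score :: "('b list \<Rightarrow> real) \<Rightarrow> 'b list list \<Rightarrow> real" where
  "opt_score S ws = Max {alignment_score S ws k \<pi> | k \<pi>. is_alignment ws k \<pi>}"

end

theory Submission
  imports Defs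
begin

text \<open>Let \<open>\<Phi>(n\<^sub>1, \<dots>, n\<^sub>m) = E exp (t L)\<close> for words of lengths \<open>n\<^sub>1, \<dots>, n\<^sub>m\<close>. Superadditivity of
  the score makes \<open>\<Phi>\<close> supermultiplicative, and symmetry makes it invariant under cyclic shifts, so
  \<open>\<Phi>(n\<^sub>1, \<dots>, n\<^sub>m)\<^sup>m \<le> \<Phi>(n, \<dots>, n)\<close> when \<open>n\<^sub>1 + \<dots> + n\<^sub>m = n\<close>. Conversely, an optimal alignment of \<open>m\<close>
  words of length \<open>n N\<close> can be cut into \<open>m N\<close> pieces of total length \<open>n\<close>, losing one column per cut;
  each cut has at most \<open>(n + 1)\<^sup>m\<close> possible length vectors, whence
  \<open>\<Phi>(N, \<dots>, N)\<^sup>n \<le> \<Phi>(n N, \<dots>, n N) \<le> ((n + 1)\<^sup>m exp (t s) \<Phi>(n, \<dots>, n)\<^bsup>1/m\<^esup>)\<^bsup>m N\<^esup>\<close>. Jensen's inequality bounds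
  the left side below by \<open>exp (t n E L\<^sub>N)\<close>, and a bounded-difference estimate bounds
  \<open>\<Phi>(n, \<dots>, n)\<close> by \<open>exp (t E L\<^sub>n + m n t\<^sup>2 D\<^sup>2)\<close>. Taking \<open>t\<close> of order \<open>sqrt (ln n / n)\<close> gives the rate.\<close>

subsection \<open>Averages over finite product weights\<close>

text \<open>A word over a finite alphabet takes finitely many values, so expectations are kept as
  finite weighted sums; \<open>expectation_iid_words\<close> makes the link to the probability
  space.\<close>

definition wavg :: "('b \<Rightarrow> real) \<Rightarrow> 'b set \<Rightarrow> ('b \<Rightarrow> real) \<Rightarrow> real" where
  "wavg q B f = (\<Sum>b\<in>B. q b * f b)"

definition weights_on :: "('b \<Rightarrow> real) \<Rightarrow> 'b set \<Rightarrow> bool" where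
  "weights_on q B \<longleftrightarrow> finite B \<and> (\<forall>b\<in>B. 0 \<le> q b) \<and> sum q B = 1"

text \<open>The law of independent coordinates. It is meant to be iterated:
  \<open>prod_weight (prod_weight p)\<close> weighs tuples of words.\<close>

definition prod_weight :: "('b \<Rightarrow> real) \<Rightarrow> 'b list \<Rightarrow> real" where
  "prod_weight q xs = prod_list (map q xs)"

lemma wavg_mono:
  assumes "weights_on q B" "\<And>b. b \<in> B \<Longrightarrow> f b \<le> g b"
  shows "wavg q B f \<le> wavg q B g"
  using assms unfolding wavg_def weights_on_def by (intro sum_mono mult_left_mono) auto

lemma wavg_cong: "(\<And>b. b \<in> B \<Longrightarrow> f b = g b) \<Longrightarrow> wavg q B f = wavg q B g"
  unfolding wavg_def by (rule sum.cong) auto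

lemma wavg_const: "weights_on q B \<Longrightarrow> wavg q B (\<lambda>_. c) = c"
  unfolding wavg_def weights_on_def by (simp add: sum_distrib_right[symmetric])

lemma wavg_add: "wavg q B (\<lambda>b. f b + g b) = wavg q B f + wavg q B g"
  unfolding wavg_def by (simp add: distrib_left sum.distrib)

lemma wavg_diff: "wavg q B (\<lambda>b. f b - g b) = wavg q B f - wavg q B g"
  unfolding wavg_def by (simp add: right_diff_distrib sum_subtractf)

lemma wavg_cmult: "wavg q B (\<lambda>b. c * f b) = c * wavg q B f"
  unfolding wavg_def by (simp add: sum_distrib_left mult.left_commute)

lemma wavg_multc: "wavg q B (\<lambda>b. f b * c) = wavg q B f * c"
  unfolding wavg_def by (simp add: sum_distrib_right mult.assoc)

lemma wavg_sum: "wavg q B (\<lambda>b. \<Sum>i\<in>I. f i b) = (\<Sum>i\<in>I. wavg q B (f i))"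
  unfolding wavg_def by (subst sum.swap) (simp add: sum_distrib_left)

lemma wavg_swap:
  "wavg q B (\<lambda>b. wavg r C (\<lambda>c. f b c)) = wavg r C (\<lambda>c. wavg q B (\<lambda>b. f b c))"
  unfolding wavg_def sum_distrib_left by (subst sum.swap) (simp add: mult.left_commute)

lemma wavg_abs_le:
  assumes "weights_on q B" "\<And>b. b \<in> B \<Longrightarrow> \<bar>f b\<bar> \<le> c"
  shows "\<bar>wavg q B f\<bar> \<le> c"
proof -
  have "wavg q B f \<le> wavg q B (\<lambda>_. c)" using assms by (intro wavg_mono) (auto simp: abs_le_iff)
  moreover have "wavg q B (\<lambda>_. - c) \<le> wavg q B f"
    using assms by (intro wavg_mono) (auto simp: abs_le_iff minus_le_iff)
  ultimately show ?thesis using assms(1) by (simp add: wavg_const abs_le_iff)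
qed

lemma wavg_listset_Nil: "wavg (prod_weight q) (listset []) f = f []"
  by (simp add: wavg_def prod_weight_def)

lemma wavg_listset_Cons:
  "wavg (prod_weight q) (listset (B # Bs)) f =
     wavg q B (\<lambda>x. wavg (prod_weight q) (listset Bs) (\<lambda>xs. f (x # xs)))"
proof -
  have img: "listset (B # Bs) = (\<lambda>(x, xs). x # xs) ` (B \<times> listset Bs)"
    by (auto simp: set_Cons_def)
  have inj: "inj_on (\<lambda>(x, xs). x # xs) (B \<times> listset Bs)"
    by (auto simp: inj_on_def)
  show ?thesis
    unfolding wavg_def img sum.reindex[OF inj] sum_distrib_left
    by (subst sum.cartesian_product) (auto simp: prod_weight_def mult.assoc intro!: sum.cong)
qed

lemma weights_on_listset:
  "(\<And>B. B \<in> set Bs \<Longrightarrow> weights_on q B) \<Longrightarrow> weights_on (prod_weight q) (listset Bs)"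
proof (induction Bs)
  case Nil
  then show ?case by (simp add: weights_on_def prod_weight_def)
next
  case (Cons B Bs)
  have B: "weights_on q B" and Bs: "weights_on (prod_weight q) (listset Bs)"
    using Cons by auto
  have "listset (B # Bs) = (\<lambda>(x, xs). x # xs) ` (B \<times> listset Bs)"
    by (auto simp: set_Cons_def)
  then have "finite (listset (B # Bs))"
    using B Bs by (simp add: weights_on_def)
  moreover have "\<forall>xs\<in>listset (B # Bs). 0 \<le> prod_weight q xs"
    using B Bs by (auto simp: weights_on_def set_Cons_def prod_weight_def)
  moreover have "wavg (prod_weight q) (listset (B # Bs)) (\<lambda>_. 1) = 1"
    unfolding wavg_listset_Cons by (simp only: wavg_const[OF B] wavg_const[OF Bs])
  then have "sum (prod_weight q) (listset (B # Bs)) = 1"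
    by (simp add: wavg_def)
  ultimately show ?case unfolding weights_on_def by blast
qed

lemma wavg_listset_append:
  "wavg (prod_weight q) (listset (Bs @ Cs)) f =
     wavg (prod_weight q) (listset Bs) (\<lambda>xs. wavg (prod_weight q) (listset Cs) (\<lambda>ys. f (xs @ ys)))"
proof (induction Bs arbitrary: f)
  case Nil
  then show ?case unfolding wavg_listset_Nil by simp
next
  case (Cons B Bs)
  show ?case unfolding append_Cons wavg_listset_Cons Cons.IH ..
qed

lemma listset_replicate: "listset (replicate n A) = {xs. length xs = n \<and> set xs \<subseteq> A}"
proof (induction n)
  case (Suc n)
  then show ?case by (auto simp: set_Cons_def length_Suc_conv)
qed auto

lemma mem_listset_iff: "xs \<in> listset Bs \<longleftrightarrow> list_all2 (\<in>) xs Bs"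
proof (induction Bs arbitrary: xs)
  case (Cons B Bs)
  then show ?case by (auto simp: set_Cons_def list_all2_Cons2)
qed auto

text \<open>The relation \<open>r\<close> says which changes of the argument count as elementary, so that the bound
  can be iterated from letters to words (\<open>listrel1 UNIV\<close>) and on to tuples of words
  (\<open>listrel1 (listrel1 UNIV)\<close>).\<close>

definition mgf_bound ::
    "real \<Rightarrow> real \<Rightarrow> ('b \<Rightarrow> real) \<Rightarrow> ('b \<times> 'b) set \<Rightarrow> 'b set \<Rightarrow> real \<Rightarrow> bool" where
  "mgf_bound t D q r B v \<longleftrightarrow>
     (\<forall>f. (\<forall>x\<in>B. \<forall>y\<in>B. (x, y) \<in> r \<longrightarrow> \<bar>f x - f y\<bar> \<le> D) \<longrightarrow>
        wavg q B (\<lambda>x. exp (t * f x)) \<le> exp (t * wavg q B f + v))"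

section \<open>Exponential moments under bounded differences\<close>

lemma exp_le_quadratic:
  fixes x :: real
  assumes "\<bar>x\<bar> \<le> 1"
  shows "exp x \<le> 1 + x + x\<^sup>2"
proof (cases "0 \<le> x")
  case True
  then show ?thesis using assms by (intro exp_bound) auto
next
  case False
  define y where "y = - x"
  have y: "0 < y" "y \<le> 1" using False assms by (auto simp: y_def)
  \<comment> \<open>The product equals \<open>1 + y ^ 3\<close>.\<close>
  have "1 \<le> (1 - y + y\<^sup>2) * (1 + y)"
    using y by (simp add: algebra_simps power2_eq_square)
  also have "\<dots> \<le> (1 - y + y\<^sup>2) * exp y"
    using y by (intro mult_left_mono) (auto simp: exp_ge_add_one_self)
  finally have "exp (- y) \<le> 1 - y + y\<^sup>2"
    by (simp add: exp_minus field_simps)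
  then show ?thesis by (simp add: y_def)
qed

text \<open>After centring at the mean \<open>e\<close>, the linear term of
  \<open>exp_le_quadratic\<close> averages to zero. The quadratic term is at most
  \<open>(t * D) ^ 2\<close>, because an oscillation of at most \<open>D\<close> bounds every
  deviation from the mean.\<close>

lemma mgf_bound_UNIV:
  assumes q: "weights_on q B" and t: "0 \<le> t" "t * D \<le> 1"
  shows "mgf_bound t D q UNIV B (t\<^sup>2 * D\<^sup>2)"
  unfolding mgf_bound_def
proof (intro allI impI)
  fix f
  assume f: "\<forall>x\<in>B. \<forall>y\<in>B. (x, y) \<in> UNIV \<longrightarrow> \<bar>f x - f y\<bar> \<le> D"
  define e where "e = wavg q B f"
  have dev: "\<bar>t * (f x - e)\<bar> \<le> t * D" if "x \<in> B" for x
  proof -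
    have "\<bar>wavg q B (\<lambda>y. f x - f y)\<bar> \<le> D"
      using that f by (intro wavg_abs_le[OF q]) auto
    then have "\<bar>f x - e\<bar> \<le> D"
      by (simp add: wavg_diff wavg_const[OF q] e_def)
    then show ?thesis using t by (simp add: abs_mult mult_left_mono)
  qed
  have "wavg q B (\<lambda>x. exp (t * (f x - e))) \<le> wavg q B (\<lambda>x. (1 + t\<^sup>2 * D\<^sup>2) + t * (f x - e))"
  proof (rule wavg_mono[OF q])
    fix x assume x: "x \<in> B"
    have "\<bar>t * (f x - e)\<bar> \<le> 1" using dev[OF x] t by linarith
    from exp_le_quadratic[OF this]
    have "exp (t * (f x - e)) \<le> 1 + t * (f x - e) + (t * (f x - e))\<^sup>2" .
    also have "(t * (f x - e))\<^sup>2 \<le> (t * D)\<^sup>2"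
      by (rule abs_le_square_iff[THEN iffD1]) (use dev[OF x] in linarith)
    finally show "exp (t * (f x - e)) \<le> (1 + t\<^sup>2 * D\<^sup>2) + t * (f x - e)"
      by (simp add: power_mult_distrib)
  qed
  also have "\<dots> = 1 + t\<^sup>2 * D\<^sup>2"
    by (simp add: wavg_add wavg_const[OF q] wavg_cmult wavg_diff e_def)
  also have "\<dots> \<le> exp (t\<^sup>2 * D\<^sup>2)" by (rule exp_ge_add_one_self)
  finally have "exp (t * e) * wavg q B (\<lambda>x. exp (t * (f x - e))) \<le> exp (t * e) * exp (t\<^sup>2 * D\<^sup>2)"
    by (intro mult_left_mono) auto
  also have "exp (t * e) * wavg q B (\<lambda>x. exp (t * (f x - e))) = wavg q B (\<lambda>x. exp (t * f x))"
    unfolding wavg_cmult[symmetric] exp_add[symmetric] by (simp add: right_diff_distrib)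
  finally show "wavg q B (\<lambda>x. exp (t * f x)) \<le> exp (t * wavg q B f + t\<^sup>2 * D\<^sup>2)"
    by (simp add: exp_add e_def)
qed

text \<open>Tensorization as in the martingale method: given the first coordinate, induction bounds
  the average over the tail; the conditional mean is then averaged over the first coordinate, and
  the exponents add up.\<close>

lemma mgf_bound_listset:
  assumes "list_all2 (\<lambda>B v. weights_on q B \<and> mgf_bound t D q r B v) Bs vs" and D: "0 \<le> D"
  shows "mgf_bound t D (prod_weight q) (listrel1 r) (listset Bs) (sum_list vs)"
  using assms(1)
proof (induction rule: list_all2_induct)
  case Nil
  then show ?case unfolding mgf_bound_def wavg_listset_Nil by simp
next
  case (Cons B Bs v vs)
  have B: "weights_on q B" "mgf_bound t D q r B v" using Cons by auto
  have Bs: "weights_on (prod_weight q) (listset Bs)"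
    using Cons(2) by (intro weights_on_listset) (auto simp: list_all2_conv_all_nth in_set_conv_nth)
  show ?case unfolding mgf_bound_def
  proof (intro allI impI)
    fix f
    assume f: "\<forall>x\<in>listset (B # Bs). \<forall>y\<in>listset (B # Bs). (x, y) \<in> listrel1 r \<longrightarrow> \<bar>f x - f y\<bar> \<le> D"
    let ?E = "wavg (prod_weight q) (listset Bs)"
    define g where "g x = ?E (\<lambda>xs. f (x # xs))" for x
    have inner: "?E (\<lambda>xs. exp (t * f (x # xs))) \<le> exp (t * g x + sum_list vs)" if "x \<in> B" for x
      using Cons.IH f that unfolding mgf_bound_def g_def
      by (auto simp: set_Cons_def)
    \<comment> \<open>Changing the head along \<open>r\<close> is one \<open>listrel1 r\<close> step
      of the whole list, and averaging over the tail preserves the bound \<open>D\<close>.\<close>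
    have "\<bar>g x - g y\<bar> \<le> D" if "x \<in> B" "y \<in> B" "(x, y) \<in> r" for x y
      unfolding g_def wavg_diff[symmetric] using that f
      by (intro wavg_abs_le[OF Bs]) (auto simp: set_Cons_def)
    then have outer: "wavg q B (\<lambda>x. exp (t * g x)) \<le> exp (t * wavg q B g + v)"
      using B(2) unfolding mgf_bound_def by blast
    have "wavg (prod_weight q) (listset (B # Bs)) (\<lambda>x. exp (t * f x))
        \<le> wavg q B (\<lambda>x. exp (t * g x + sum_list vs))"
      unfolding wavg_listset_Cons by (intro wavg_mono B inner)
    also have "\<dots> = wavg q B (\<lambda>x. exp (t * g x)) * exp (sum_list vs)"
      by (simp add: exp_add wavg_multc)
    also have "\<dots> \<le> exp (t * wavg q B g + v) * exp (sum_list vs)"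
      using outer by (intro mult_right_mono) auto
    also have "\<dots> = exp (t * wavg (prod_weight q) (listset (B # Bs)) f + sum_list (v # vs))"
      unfolding wavg_listset_Cons g_def by (simp add: exp_add)
    finally show "wavg (prod_weight q) (listset (B # Bs)) (\<lambda>x. exp (t * f x))
        \<le> exp (t * wavg (prod_weight q) (listset (B # Bs)) f + sum_list (v # vs))" .
  qed
qed

subsection \<open>Optimal alignments\<close>

definition attained_scores :: "('b list \<Rightarrow> real) \<Rightarrow> 'b list list \<Rightarrow> real set" where
  "attained_scores S ws = {alignment_score S ws k \<pi> | k \<pi>. is_alignment ws k \<pi>}"

definition column :: "'b list list \<Rightarrow> (nat \<Rightarrow> nat \<Rightarrow> nat) \<Rightarrow> nat \<Rightarrow> 'b list" where
  "column ws \<pi> i = map (\<lambda>j. ws ! j ! \<pi> j i) [0..<length ws]"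

lemma alignment_score_column: "alignment_score S ws k \<pi> = (\<Sum>i<k. S (column ws \<pi> i))"
  by (simp add: alignment_score_def column_def)

lemma length_column [simp]: "length (column ws \<pi> i) = length ws"
  by (simp add: column_def)

lemma is_alignmentD:
  assumes "is_alignment ws k \<pi>" "j < length ws"
  shows "i < k \<Longrightarrow> \<pi> j i < length (ws ! j)"
    and "i < i' \<Longrightarrow> i' < k \<Longrightarrow> \<pi> j i < \<pi> j i'"
  using assms by (auto simp: is_alignment_def strict_mono_on_def)

lemma is_alignment_leD:
  assumes "is_alignment ws k \<pi>" "j < length ws" "i \<le> i'" "i' < k"
  shows "\<pi> j i \<le> \<pi> j i'"
  using is_alignmentD(2)[OF assms(1,2), of i i'] assms(3,4) by (cases "i = i'") auto

lemma is_alignmentI: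
  assumes "\<And>j i. j < length ws \<Longrightarrow> i < k \<Longrightarrow> \<pi> j i < length (ws ! j)"
    and "\<And>j i i'. j < length ws \<Longrightarrow> i < i' \<Longrightarrow> i' < k \<Longrightarrow> \<pi> j i < \<pi> j i'"
  shows "is_alignment ws k \<pi>"
  using assms by (auto simp: is_alignment_def strict_mono_on_def)

lemma set_column:
  assumes "is_alignment ws k \<pi>" "i < k" "\<forall>w\<in>set ws. set w \<subseteq> A"
  shows "set (column ws \<pi> i) \<subseteq> A"
  using assms is_alignmentD(1)[OF assms(1) _ assms(2)]
  by (fastforce simp: column_def dest: nth_mem)

lemma is_alignment_length:
  assumes "is_alignment ws k \<pi>" "ws \<noteq> []"
  shows "k \<le> length (hd ws)"
proof -
  have "inj_on (\<pi> 0) {..<k}" "\<pi> 0 ` {..<k} \<subseteq> {..<length (hd ws)}"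
    using assms by (auto simp: is_alignment_def hd_conv_nth strict_mono_on_imp_inj_on)
  from card_inj_on_le[OF this] show ?thesis by simp
qed

text \<open>The index functions are infinitely many, but a score depends only on the list of
  columns. Its entries are lists over the letters of \<open>ws\<close>, and the first word, which
  exists by \<open>ws \<noteq> []\<close>, bounds its length.\<close>

lemma finite_attained_scores:
  assumes "ws \<noteq> []"
  shows "finite (attained_scores S ws)"
proof -
  let ?A = "\<Union>(set (map set ws))" and ?K = "length (hd ws)"
  let ?C = "{c. set c \<subseteq> ?A \<and> length c = length ws}"
  let ?R = "\<Union>k\<le>?K. (\<lambda>cs. \<Sum>i<k. S (cs ! i)) ` {cs. set cs \<subseteq> ?C \<and> length cs = k}"
  have "finite ?C" by (intro finite_lists_length_eq) auto
  then have "finite ?R" by (intro finite_UN_I finite_imageI finite_lists_length_eq) auto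
  moreover have "attained_scores S ws \<subseteq> ?R"
  proof
    fix x assume "x \<in> attained_scores S ws"
    then obtain k \<pi> where a: "is_alignment ws k \<pi>" and x: "x = alignment_score S ws k \<pi>"
      by (auto simp: attained_scores_def)
    let ?cs = "map (column ws \<pi>) [0..<k]"
    have "x = (\<Sum>i<k. S (?cs ! i))" by (simp add: x alignment_score_column)
    moreover have "set (column ws \<pi> i) \<subseteq> ?A" if "i < k" for i
      by (rule set_column[OF a that]) auto
    then have "?cs \<in> {cs. set cs \<subseteq> ?C \<and> length cs = k}" by fastforce
    ultimately show "x \<in> ?R"
      using is_alignment_length[OF a assms] by blast
  qed
  ultimately show ?thesis by (rule finite_subset[rotated])
qed

lemma opt_score_ge:
  assumes "ws \<noteq> []" "is_alignment ws k \<pi>"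
  shows "alignment_score S ws k \<pi> \<le> opt_score S ws"
  unfolding opt_score_def attained_scores_def[symmetric]
  using assms by (intro Max_ge finite_attained_scores) (auto simp: attained_scores_def)

lemma opt_score_attained:
  assumes "ws \<noteq> []"
  obtains k \<pi> where "is_alignment ws k \<pi>" "opt_score S ws = alignment_score S ws k \<pi>"
proof -
  have "is_alignment ws 0 (\<lambda>_ _. 0)" by (rule is_alignmentI) auto
  then have "attained_scores S ws \<noteq> {}" by (auto simp: attained_scores_def)
  from Max_in[OF finite_attained_scores[OF assms] this]
  have "opt_score S ws \<in> attained_scores S ws"
    by (simp add: opt_score_def attained_scores_def)
  then show ?thesis using that by (auto simp: attained_scores_def)
qed

lemma opt_score_empty_word:
  assumes "ws \<noteq> []" "hd ws = []"
  shows "opt_score S ws = 0"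
proof -
  obtain k \<pi> where a: "is_alignment ws k \<pi>" "opt_score S ws = alignment_score S ws k \<pi>"
    by (rule opt_score_attained[OF assms(1)])
  have "k = 0" using is_alignment_length[OF a(1) assms(1)] assms(2) by simp
  with a(2) show ?thesis by (simp add: alignment_score_def)
qed

section \<open>Superadditivity, symmetry and stability of the optimal score\<close>

lemma opt_score_append_ge:
  assumes len: "length us = length vs" and ne: "us \<noteq> []"
  shows "opt_score S us + opt_score S vs \<le> opt_score S (map2 (@) us vs)"
proof -
  let ?ws = "map2 (@) us vs"
  have ne': "vs \<noteq> []" "?ws \<noteq> []" using len ne by (auto simp: zip_eq_Nil_iff)
  obtain k \<pi> where a: "is_alignment us k \<pi>" "opt_score S us = alignment_score S us k \<pi>"
    by (rule opt_score_attained[OF ne])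
  obtain l \<rho> where b: "is_alignment vs l \<rho>" "opt_score S vs = alignment_score S vs l \<rho>"
    by (rule opt_score_attained[OF ne'(1)])
  \<comment> \<open>The alignment of \<open>us\<close> comes first; that of \<open>vs\<close>
    follows, with its indices shifted past the words of \<open>us\<close>.\<close>
  define \<tau> where "\<tau> j i = (if i < k then \<pi> j i else length (us ! j) + \<rho> j (i - k))" for j i
  have al: "is_alignment ?ws (k + l) \<tau>"
  proof (rule is_alignmentI)
    fix j i assume "j < length ?ws" "i < k + l"
    then show "\<tau> j i < length (?ws ! j)"
      using is_alignmentD(1)[OF a(1), of j i] is_alignmentD(1)[OF b(1), of j "i - k"] len
      by (auto simp: \<tau>_def)
  next
    fix j i i' assume "j < length ?ws" "i < i'" "i' < k + l"
    then show "\<tau> j i < \<tau> j i'"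
      using is_alignmentD[OF a(1), of j i] is_alignmentD(2)[OF b(1), of j "i - k" "i' - k"] len
      by (auto simp: \<tau>_def)
  qed
  have c1: "column ?ws \<tau> i = column us \<pi> i" if "i < k" for i
    using that len is_alignmentD(1)[OF a(1)] by (auto simp: column_def \<tau>_def nth_append)
  have c2: "column ?ws \<tau> (k + i) = column vs \<rho> i" for i
    using len by (auto simp: column_def \<tau>_def nth_append)
  have "(\<Sum>i<k + l. S (column ?ws \<tau> i))
      = (\<Sum>i<k. S (column us \<pi> i)) + (\<Sum>i<l. S (column vs \<rho> i))"
    by (induction l) (simp_all add: c1 c2)
  then have "alignment_score S ?ws (k + l) \<tau> = opt_score S us + opt_score S vs"
    by (simp add: a b alignment_score_column)
  with opt_score_ge[OF ne'(2) al, of S] show ?thesis by simp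
qed

text \<open>Moving the first row of an alignment to the end permutes each column, and
  \<open>S\<close> ignores the order within a column. Cyclic shifts are what the later balancing of
  word lengths uses.\<close>

lemma opt_score_rotate1_ge:
  assumes sym: "\<And>x y. length x = length (w # ws) \<Longrightarrow> set x \<subseteq> A \<Longrightarrow> mset y = mset x \<Longrightarrow> S y = S x"
    and A: "\<forall>u\<in>set (w # ws). set u \<subseteq> A"
  shows "opt_score S (w # ws) \<le> opt_score S (ws @ [w])"
proof -
  obtain k \<pi> where a: "is_alignment (w # ws) k \<pi>"
      "opt_score S (w # ws) = alignment_score S (w # ws) k \<pi>"
    by (rule opt_score_attained) auto
  define \<tau> where "\<tau> j = (if j < length ws then \<pi> (Suc j) else \<pi> 0)" for j
  have al: "is_alignment (ws @ [w]) k \<tau>"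
  proof (rule is_alignmentI)
    fix j i assume j: "j < length (ws @ [w])" and i: "i < k"
    show "\<tau> j i < length ((ws @ [w]) ! j)"
    proof (cases "j < length ws")
      case True
      then show ?thesis
        using is_alignmentD(1)[OF a(1) _ i, of "Suc j"] by (simp add: \<tau>_def nth_append)
    next
      case False
      then have "j = length ws" using j by simp
      then show ?thesis using is_alignmentD(1)[OF a(1) _ i, of 0] by (simp add: \<tau>_def)
    qed
  next
    fix j i i' assume "j < length (ws @ [w])" "i < i'" "i' < k"
    then show "\<tau> j i < \<tau> j i'"
      using is_alignmentD(2)[OF a(1), of "Suc j" i i'] is_alignmentD(2)[OF a(1), of 0 i i']
      by (auto simp: \<tau>_def)
  qed
  have "S (column (ws @ [w]) \<tau> i) = S (column (w # ws) \<pi> i)" if "i < k" for i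
  proof (rule sym)
    have "column (w # ws) \<pi> i = w ! \<pi> 0 i # map (\<lambda>j. ws ! j ! \<pi> (Suc j) i) [0..<length ws]"
      by (simp add: column_def upt_conv_Cons map_Suc_upt[symmetric] del: upt_Suc map_Suc_upt)
    moreover have "column (ws @ [w]) \<tau> i
        = map (\<lambda>j. ws ! j ! \<pi> (Suc j) i) [0..<length ws] @ [w ! \<pi> 0 i]"
      by (simp add: column_def \<tau>_def nth_append)
    ultimately show "mset (column (ws @ [w]) \<tau> i) = mset (column (w # ws) \<pi> i)" by simp
  qed (use set_column[OF a(1) that A] in auto)
  then have "alignment_score S (ws @ [w]) k \<tau> = opt_score S (w # ws)"
    by (simp add: a alignment_score_column)
  with opt_score_ge[OF _ al, of S] show ?thesis by simp
qed

text \<open>The changed letter is read by at most one column of an optimal alignment.\<close>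

lemma opt_score_change_letter:
  assumes rel: "(ws, ws') \<in> listrel1 (listrel1 UNIV)"
    and A: "\<forall>u\<in>set ws. set u \<subseteq> A" "\<forall>u\<in>set ws'. set u \<subseteq> A"
    and D: "0 \<le> D"
    and lip: "\<And>x y. length x = length ws \<Longrightarrow> set x \<subseteq> A \<Longrightarrow> length y = length ws \<Longrightarrow> set y \<subseteq> A \<Longrightarrow>
                card {i. i < length ws \<and> x ! i \<noteq> y ! i} \<le> 1 \<Longrightarrow> \<bar>S x - S y\<bar> \<le> D"
  shows "opt_score S ws \<le> opt_score S ws' + D"
proof -
  from rel obtain us w w' vs where w: "(w, w') \<in> listrel1 UNIV"
    and ws: "ws = us @ w # vs" "ws' = us @ w' # vs"
    by (rule listrel1E)
  from w obtain xs a b ys where w: "w = xs @ a # ys" "w' = xs @ b # ys"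
    by (auto simp: listrel1_def)
  \<comment> \<open>The changed letter sits in word \<open>J\<close> at position \<open>Q\<close>,
    so column \<open>i\<close> sees it only if \<open>\<pi> J i = Q\<close>.\<close>
  define J where "J = length us"
  define Q where "Q = length xs"
  have ne: "ws \<noteq> []" "ws' \<noteq> []" and len: "length ws' = length ws" by (auto simp: ws)
  have lenj: "length (ws' ! j) = length (ws ! j)" for j
    by (auto simp: ws w nth_append nth_Cons split: nat.splits)
  have same: "ws' ! j ! q = ws ! j ! q" if "j \<noteq> J \<or> q \<noteq> Q" for j q
    using that by (auto simp: ws w J_def Q_def nth_append nth_Cons split: nat.splits)
  have J: "J < length ws" by (simp add: ws J_def)
  obtain k \<pi> where a: "is_alignment ws k \<pi>" "opt_score S ws = alignment_score S ws k \<pi>"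
    by (rule opt_score_attained[OF ne(1)])
  have al: "is_alignment ws' k \<pi>" using a(1) by (simp add: is_alignment_def len lenj)
  let ?d = "\<lambda>i. S (column ws \<pi> i) - S (column ws' \<pi> i)"
  have eq: "?d i = 0" if "\<pi> J i \<noteq> Q" for i
  proof -
    have "column ws' \<pi> i = column ws \<pi> i"
      unfolding column_def len using that by (intro map_cong) (auto intro!: same)
    then show ?thesis by simp
  qed
  have le: "?d i \<le> D" if "i < k" for i
  proof -
    have "{j. j < length ws \<and> column ws \<pi> i ! j \<noteq> column ws' \<pi> i ! j} \<subseteq> {J}"
      by (auto simp: column_def len) (metis same)
    then have "card {j. j < length ws \<and> column ws \<pi> i ! j \<noteq> column ws' \<pi> i ! j} \<le> card {J}"
      by (intro card_mono) auto
    then have "\<bar>?d i\<bar> \<le> D"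
      using set_column[OF a(1) that A(1)] set_column[OF al that A(2)] len by (intro lip) auto
    then show ?thesis by simp
  qed
  have "(\<Sum>i<k. ?d i) \<le> D"
  proof (cases "\<exists>i<k. \<pi> J i = Q")
    case True
    then obtain i where i: "i < k" "\<pi> J i = Q" by blast
    \<comment> \<open>Strict monotonicity of \<open>\<pi> J\<close> keeps every other column away
      from position \<open>Q\<close>.\<close>
    have "?d i' = 0" if "i' \<in> {..<k} - {i}" for i'
      using is_alignmentD(2)[OF a(1) J, of i i'] is_alignmentD(2)[OF a(1) J, of i' i] that i
      by (intro eq) (cases "i' < i"; auto)
    then have "(\<Sum>i'<k. ?d i') = (\<Sum>i'\<in>{i}. ?d i')"
      using i by (intro sum.mono_neutral_right) auto
    then show ?thesis using le[OF i(1)] by simp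
  next
    case False
    then have "(\<Sum>i<k. ?d i) = 0" by (intro sum.neutral ballI eq) auto
    then show ?thesis using D by simp
  qed
  then have "opt_score S ws \<le> alignment_score S ws' k \<pi> + D"
    by (simp add: a alignment_score_column sum_subtractf)
  with opt_score_ge[OF ne(2) al, of S] show ?thesis by simp
qed

section \<open>Cutting an alignment at a prescribed total length\<close>

lemma sum_interpolate:
  fixes lo hi :: "nat \<Rightarrow> nat"
  assumes "\<And>j. j < m \<Longrightarrow> lo j \<le> hi j" "sum lo {..<m} \<le> T" "T \<le> sum hi {..<m}"
  obtains x where "\<And>j. j < m \<Longrightarrow> lo j \<le> x j" "\<And>j. j < m \<Longrightarrow> x j \<le> hi j" "sum x {..<m} = T"
proof -
  have "\<exists>x. (\<forall>j<m. lo j \<le> x j \<and> x j \<le> hi j) \<and> sum x {..<m} = T"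
    using assms(2,3)
  proof (induction T rule: dec_induct)
    case base
    then show ?case using assms(1) by (intro exI[of _ lo]) auto
  next
    case (step T)
    then obtain x where x: "\<forall>j<m. lo j \<le> x j \<and> x j \<le> hi j" "sum x {..<m} = T"
      by auto
    \<comment> \<open>Discrete intermediate values: while the sum is below that of
      \<open>hi\<close>, some coordinate has room and can be raised by one.\<close>
    have "\<exists>j<m. x j < hi j"
    proof (rule ccontr)
      assume "\<not> ?thesis"
      then have "sum hi {..<m} \<le> sum x {..<m}" by (intro sum_mono) (meson lessThan_iff not_less)
      then show False using x step by simp
    qed
    then obtain j where j: "j < m" "x j < hi j" by blast
    have "sum (x(j := Suc (x j))) {..<m} = Suc (sum x {..<m})"
      using j by (simp add: sum.remove[of "{..<m}" j] )
    then show ?case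
      using x j by (intro exI[of _ "x(j := Suc (x j))"]) (auto simp: le_SucI)
  qed
  then show ?thesis using that by blast
qed

text \<open>The cut at total length \<open>T\<close> may run through a column, which is then lost.\<close>

lemma opt_score_cut:
  assumes ne: "ws \<noteq> []" and A: "\<forall>u\<in>set ws. set u \<subseteq> A"
    and S: "\<And>x. length x = length ws \<Longrightarrow> set x \<subseteq> A \<Longrightarrow> S x \<le> s" and s: "0 \<le> s"
    and T: "T \<le> sum_list (map length ws)"
  obtains ns where "length ns = length ws" "\<And>j. j < length ws \<Longrightarrow> ns ! j \<le> length (ws ! j)"
    "sum_list ns = T" "opt_score S ws \<le> s + opt_score S (map2 take ns ws) + opt_score S (map2 drop ns ws)"
proof -
  let ?m = "length ws"
  obtain k \<pi> where a: "is_alignment ws k \<pi>" "opt_score S ws = alignment_score S ws k \<pi>"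
    by (rule opt_score_attained[OF ne])
  \<comment> \<open>The length of the shortest prefix of word \<open>j\<close> containing its
    letters in the first \<open>i\<close> columns; positions start at 0, hence the
    successor.\<close>
  define lo where "lo i j = (if i = 0 then 0 else Suc (\<pi> j (i - 1)))" for i j
  \<comment> \<open>The largest number of whole columns that fit into total length
    \<open>T\<close>.\<close>
  define i where "i = Max {i. i \<le> k \<and> sum (lo i) {..<?m} \<le> T}"
  have fin: "finite {i. i \<le> k \<and> sum (lo i) {..<?m} \<le> T}" by simp
  have "0 \<in> {i. i \<le> k \<and> sum (lo i) {..<?m} \<le> T}" by (simp add: lo_def)
  from Max_in[OF fin] this have i: "i \<le> k" "sum (lo i) {..<?m} \<le> T"
    unfolding i_def[symmetric] by blast+
  have imax: "T < sum (lo (Suc i)) {..<?m}" if "i < k"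
    using Max_ge[OF fin, of "Suc i"] that unfolding i_def[symmetric] by fastforce
  \<comment> \<open>The cut may reach to the end of column \<open>i\<close>, or to the end of the
    words if no column is left. By maximality of \<open>i\<close>, \<open>T\<close> lies between the
    sums of \<open>lo i\<close> and \<open>hi\<close>.\<close>
  define hi where "hi j = (if i < k then lo (Suc i) j else length (ws ! j))" for j
  have hi: "hi j \<le> length (ws ! j)" if "j < ?m" for j
    using is_alignmentD(1)[OF a(1) that, of i] by (auto simp: hi_def lo_def)
  have lohi: "lo i j \<le> hi j" if "j < ?m" for j
    using is_alignmentD(2)[OF a(1) that, of "i - 1" i] is_alignmentD(1)[OF a(1) that, of "i - 1"] i
    by (auto simp: hi_def lo_def)
  have "T \<le> sum hi {..<?m}"
  proof (cases "i < k")
    case True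
    then show ?thesis using imax by (simp add: hi_def)
  next
    case False
    then show ?thesis using T by (simp add: hi_def sum_list_sum_nth atLeast0LessThan)
  qed
  then obtain x where x: "\<And>j. j < ?m \<Longrightarrow> lo i j \<le> x j" "\<And>j. j < ?m \<Longrightarrow> x j \<le> hi j" "sum x {..<?m} = T"
    using sum_interpolate[of ?m "lo i" hi T] lohi i by blast
  define ns where "ns = map x [0..<?m]"
  let ?us = "map2 take ns ws" and ?vs = "map2 drop ns ws"
  have ns: "length ns = ?m" "\<And>j. j < ?m \<Longrightarrow> ns ! j = x j" by (auto simp: ns_def)
  have ne': "?us \<noteq> []" "?vs \<noteq> []" using ne ns by (auto simp: zip_eq_Nil_iff)
  have xl: "x j \<le> length (ws ! j)" if "j < ?m" for j using x(2) hi that le_trans by blast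
  have before: "\<pi> j i' < x j" if "j < ?m" "i' < i" for j i'
  proof -
    have "\<pi> j i' \<le> \<pi> j (i - 1)" using that i by (intro is_alignment_leD[OF a(1)]) auto
    moreover have "Suc (\<pi> j (i - 1)) \<le> x j" using x(1)[OF that(1)] that(2) by (simp add: lo_def)
    ultimately show ?thesis by simp
  qed
  \<comment> \<open>The cut may be as large as \<open>Suc (\<pi> j i)\<close>, so only columns
    strictly after \<open>i\<close> are certain to lie in the right part.\<close>
  have after: "x j \<le> \<pi> j i'" if "j < ?m" "i < i'" "i' < k" for j i'
    using x(2)[of j] is_alignmentD(2)[OF a(1), of j i i'] that by (auto simp: hi_def lo_def)
  \<comment> \<open>Column \<open>i\<close> is left out: \<open>l\<close> counts the columns after
    it, and \<open>\<rho>\<close> measures positions from the cut.\<close>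
  define l where "l = k - Suc i"
  define \<rho> where "\<rho> j i' = \<pi> j (Suc i + i') - x j" for j i'
  have al1: "is_alignment ?us i \<pi>"
    using is_alignmentD[OF a(1)] ns i xl before by (intro is_alignmentI) (auto simp: min_def)
  have al2: "is_alignment ?vs l \<rho>"
  proof (rule is_alignmentI)
    fix j i' assume *: "j < length ?vs" "i' < l"
    then have "\<pi> j (Suc i + i') < length (ws ! j)" "x j \<le> \<pi> j (Suc i + i')"
      using ns by (auto intro!: is_alignmentD(1)[OF a(1)] after simp: l_def)
    then show "\<rho> j i' < length (?vs ! j)" using * ns by (auto simp: \<rho>_def)
  next
    fix j i' i'' assume "j < length ?vs" "i' < i''" "i'' < l"
    then have "\<pi> j (Suc i + i') < \<pi> j (Suc i + i'')" "x j \<le> \<pi> j (Suc i + i')"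
      using ns by (auto intro!: is_alignmentD(2)[OF a(1)] after simp: l_def)
    then show "\<rho> j i' < \<rho> j i''" by (auto simp: \<rho>_def)
  qed
  have c1: "column ?us \<pi> i' = column ws \<pi> i'" if "i' < i" for i'
    using that ns before by (auto simp: column_def)
  have c2: "column ?vs \<rho> i' = column ws \<pi> (Suc i + i')" if "i' < l" for i'
  proof -
    have "drop (x j) (ws ! j) ! \<rho> j i' = ws ! j ! \<pi> j (Suc i + i')" if "j < ?m" for j
      using after[OF that, of "Suc i + i'"] xl[OF that] \<open>i' < l\<close> by (auto simp: l_def \<rho>_def)
    then show ?thesis using ns by (auto simp: column_def)
  qed
  have "opt_score S ws = (\<Sum>i'<k. S (column ws \<pi> i'))" by (simp add: a alignment_score_column)
  \<comment> \<open>Only column \<open>i\<close>, worth at most \<open>s\<close>, is missing; for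
    \<open>i = k\<close> nothing is lost.\<close>
  also have "\<dots> \<le> s + (\<Sum>i'<i. S (column ws \<pi> i')) + (\<Sum>i'<l. S (column ws \<pi> (Suc i + i')))"
  proof (cases "i < k")
    case True
    have "{..<k} = insert i ({..<i} \<union> {Suc i..<k})" using True by auto
    moreover have "(\<Sum>i'\<in>{..<i} \<union> {Suc i..<k}. S (column ws \<pi> i'))
        = (\<Sum>i'<i. S (column ws \<pi> i')) + (\<Sum>i'\<in>{Suc i..<k}. S (column ws \<pi> i'))"
      by (intro sum.union_disjoint) auto
    ultimately have "(\<Sum>i'<k. S (column ws \<pi> i'))
        = (\<Sum>i'<i. S (column ws \<pi> i')) + S (column ws \<pi> i) + (\<Sum>i'\<in>{Suc i..<k}. S (column ws \<pi> i'))"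
      by simp
    also have "(\<Sum>i'\<in>{Suc i..<k}. S (column ws \<pi> i')) = (\<Sum>i'<l. S (column ws \<pi> (Suc i + i')))"
      using sum.shift_bounds_nat_ivl[of "\<lambda>i'. S (column ws \<pi> i')" 0 "Suc i" l] True
      by (simp add: l_def atLeast0LessThan add.commute)
    finally show ?thesis using S[OF _ set_column[OF a(1) True A]] by simp
  next
    case False
    then have "i = k" "l = 0" using i by (auto simp: l_def)
    then show ?thesis using s by simp
  qed
  also have "\<dots> = s + alignment_score S ?us i \<pi> + alignment_score S ?vs l \<rho>"
    by (simp add: alignment_score_column c1 c2)
  also have "\<dots> \<le> s + opt_score S ?us + opt_score S ?vs"
    using opt_score_ge[OF ne'(1) al1, of S] opt_score_ge[OF ne'(2) al2, of S] by simp
  finally show ?thesis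
    using that[of ns] ns xl x(3) by (simp add: ns_def sum_list_sum_nth atLeast0LessThan)
qed

subsection \<open>Exponential moments of the optimal score\<close>

text \<open>Jensen's inequality: the tangent of \<open>exp\<close> at the mean lies below the
  graph.\<close>

lemma exp_wavg_le:
  assumes q: "weights_on q B"
  shows "exp (wavg q B f) \<le> wavg q B (\<lambda>b. exp (f b))"
proof -
  let ?e = "wavg q B f"
  have "exp ?e = wavg q B (\<lambda>b. exp ?e * (1 + (f b - ?e)))"
    unfolding wavg_cmult by (simp add: wavg_add wavg_diff wavg_const[OF q])
  also have "\<dots> \<le> wavg q B (\<lambda>b. exp ?e * exp (f b - ?e))"
    by (rule wavg_mono[OF q]) (intro mult_left_mono exp_ge_add_one_self, simp)
  also have "\<dots> = wavg q B (\<lambda>b. exp (f b))"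
    by (simp add: mult_exp_exp)
  finally show ?thesis .
qed

locale alignment_model =
  fixes A :: "'a set" and p :: "'a \<Rightarrow> real" and S :: "'a list \<Rightarrow> real" and m :: nat and s D :: real
  assumes p: "weights_on p A"
    and m: "0 < m"
    and s: "0 \<le> s"
    and D: "0 < D"
    and S_le: "\<And>x. length x = m \<Longrightarrow> set x \<subseteq> A \<Longrightarrow> S x \<le> s"
    and S_sym: "\<And>x y. length x = m \<Longrightarrow> set x \<subseteq> A \<Longrightarrow> mset y = mset x \<Longrightarrow> S y = S x"
    and S_lip: "\<And>x y. length x = m \<Longrightarrow> set x \<subseteq> A \<Longrightarrow> length y = m \<Longrightarrow> set y \<subseteq> A \<Longrightarrow>
                  card {i. i < m \<and> x ! i \<noteq> y ! i} \<le> 1 \<Longrightarrow> \<bar>S x - S y\<bar> \<le> D"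
begin

definition words :: "nat \<Rightarrow> 'a list set" where
  "words n = listset (replicate n A)"

definition tuples :: "nat list \<Rightarrow> 'a list list set" where
  "tuples ns = listset (map words ns)"

text \<open>Each word has its own length because cutting an alignment produces pieces whose words
  differ in length.\<close>

definition E :: "nat list \<Rightarrow> ('a list list \<Rightarrow> real) \<Rightarrow> real" where
  "E ns = wavg (prod_weight (prod_weight p)) (tuples ns)"

definition \<Phi> :: "real \<Rightarrow> nat list \<Rightarrow> real" where
  "\<Phi> t ns = E ns (\<lambda>ws. exp (t * opt_score S ws))"

lemma mem_words: "w \<in> words n \<longleftrightarrow> length w = n \<and> set w \<subseteq> A"
  by (simp add: words_def listset_replicate)

lemma mem_tuples:
  "ws \<in> tuples ns \<longleftrightarrow>
     length ws = length ns \<and> (\<forall>j<length ns. length (ws ! j) = ns ! j \<and> set (ws ! j) \<subseteq> A)"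
proof -
  have "ws \<in> tuples ns \<longleftrightarrow> length ws = length ns \<and> (\<forall>j<length ns. ws ! j \<in> words (ns ! j))"
    unfolding tuples_def mem_listset_iff list_all2_conv_all_nth by (metis length_map nth_map)
  then show ?thesis by (simp add: mem_words)
qed

lemma set_tuples: "ws \<in> tuples ns \<Longrightarrow> \<forall>w\<in>set ws. set w \<subseteq> A"
  unfolding mem_tuples by (metis in_set_conv_nth)

lemma map_length_tuples: "ws \<in> tuples ns \<Longrightarrow> map length ws = ns"
  by (auto simp: mem_tuples intro: nth_equalityI)

lemma weights_words: "weights_on (prod_weight p) (words n)"
  unfolding words_def using p by (intro weights_on_listset) simp

lemma weights_tuples: "weights_on (prod_weight (prod_weight p)) (tuples ns)"
  unfolding tuples_def by (intro weights_on_listset) (auto simp: weights_words)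

lemmas E_mono = wavg_mono[OF weights_tuples, folded E_def]
lemma E_cong: "(\<And>ws. ws \<in> tuples ns \<Longrightarrow> f ws = g ws) \<Longrightarrow> E ns f = E ns g"
  unfolding E_def by (rule wavg_cong)

lemma E_Cons: "E (n # ns) f = wavg (prod_weight p) (words n) (\<lambda>w. E ns (\<lambda>ws. f (w # ws)))"
  unfolding E_def tuples_def list.map wavg_listset_Cons ..

lemma wavg_words_add:
  "wavg (prod_weight p) (words (a + b)) f =
     wavg (prod_weight p) (words a) (\<lambda>u. wavg (prod_weight p) (words b) (\<lambda>v. f (u @ v)))"
  unfolding words_def replicate_add wavg_listset_append ..

text \<open>A word of length \<open>a + b\<close> is an independent prefix and suffix; exchanging
  averages gathers all prefixes before all suffixes.\<close>

lemma E_add: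
  assumes "length ns = length ns'"
  shows "E (map2 (+) ns ns') f = E ns (\<lambda>us. E ns' (\<lambda>vs. f (map2 (@) us vs)))"
  using assms
proof (induction ns ns' arbitrary: f rule: list_induct2)
  case Nil
  then show ?case by (simp add: E_def tuples_def wavg_def prod_weight_def)
next
  case (Cons n ns n' ns')
  have "E (map2 (+) (n # ns) (n' # ns')) f =
      wavg (prod_weight p) (words n) (\<lambda>u. wavg (prod_weight p) (words n') (\<lambda>v.
        E ns (\<lambda>us. E ns' (\<lambda>vs. f ((u @ v) # map2 (@) us vs)))))"
    by (simp add: E_Cons wavg_words_add Cons.IH)
  also have "\<dots> = wavg (prod_weight p) (words n) (\<lambda>u. E ns (\<lambda>us. wavg (prod_weight p) (words n') (\<lambda>v.
        E ns' (\<lambda>vs. f ((u @ v) # map2 (@) us vs)))))"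
    unfolding E_def by (intro wavg_cong wavg_swap)
  finally show ?case by (simp add: E_Cons)
qed

lemma E_rotate1: "E (ns @ [n]) f = E (n # ns) (\<lambda>ws. f (rotate1 ws))"
proof -
  have "E (ns @ [n]) f = E ns (\<lambda>ws. wavg (prod_weight p) (words n) (\<lambda>w. f (ws @ [w])))"
    unfolding E_def tuples_def map_append wavg_listset_append list.map wavg_listset_Cons
      wavg_listset_Nil ..
  also have "\<dots> = E (n # ns) (\<lambda>ws. f (rotate1 ws))"
    unfolding E_Cons rotate1.simps unfolding E_def by (rule wavg_swap)
  finally show ?thesis .
qed

lemma \<Phi>_pos: "0 < \<Phi> t ns"
proof -
  have "exp (E ns (\<lambda>ws. t * opt_score S ws)) \<le> \<Phi> t ns"
    unfolding \<Phi>_def E_def by (rule exp_wavg_le[OF weights_tuples])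
  then show ?thesis by (rule less_le_trans[OF exp_gt_zero])
qed

lemma exp_le_\<Phi>: "exp (t * E ns (opt_score S)) \<le> \<Phi> t ns"
  using exp_wavg_le[OF weights_tuples] unfolding \<Phi>_def E_def wavg_cmult[symmetric] .

text \<open>An empty first word admits only the empty alignment. This starts both inductions on
  powers below.\<close>

lemma \<Phi>_zero:
  assumes "length ns = m" "sum_list ns = 0"
  shows "\<Phi> t ns = 1"
proof -
  have "opt_score S ws = 0" if "ws \<in> tuples ns" for ws
  proof (rule opt_score_empty_word)
    show "ws \<noteq> []" using that m assms by (auto simp: mem_tuples)
    then show "hd ws = []" using that m assms by (auto simp: mem_tuples hd_conv_nth sum_list_eq_0_iff)
  qed
  then have "\<Phi> t ns = E ns (\<lambda>_. 1)" unfolding \<Phi>_def by (intro E_cong) simp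
  then show ?thesis by (simp add: E_def wavg_const[OF weights_tuples])
qed

text \<open>Prefixes and suffixes are independent, so superadditivity of the score turns into
  supermultiplicativity of its exponential moments.\<close>

lemma \<Phi>_add:
  assumes len: "length ns = m" "length ns' = m" and t: "0 \<le> t"
  shows "\<Phi> t ns * \<Phi> t ns' \<le> \<Phi> t (map2 (+) ns ns')"
proof -
  have "\<Phi> t ns * \<Phi> t ns' =
      E ns (\<lambda>us. E ns' (\<lambda>vs. exp (t * opt_score S us) * exp (t * opt_score S vs)))"
    by (simp add: \<Phi>_def E_def wavg_cmult wavg_multc)
  also have "\<dots> \<le> E ns (\<lambda>us. E ns' (\<lambda>vs. exp (t * opt_score S (map2 (@) us vs))))"
  proof (intro E_mono)
    fix us vs assume "us \<in> tuples ns" "vs \<in> tuples ns'"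
    then have "opt_score S us + opt_score S vs \<le> opt_score S (map2 (@) us vs)"
      using len m by (intro opt_score_append_ge) (auto simp: mem_tuples)
    then show "exp (t * opt_score S us) * exp (t * opt_score S vs)
        \<le> exp (t * opt_score S (map2 (@) us vs))"
      using t by (simp add: exp_add[symmetric] distrib_left[symmetric] mult_left_mono)
  qed
  also have "\<dots> = \<Phi> t (map2 (+) ns ns')"
    using len by (simp add: \<Phi>_def E_add)
  finally show ?thesis .
qed

lemma \<Phi>_rotate1:
  assumes len: "length ns = m" and t: "0 \<le> t"
  shows "\<Phi> t ns \<le> \<Phi> t (rotate1 ns)"
proof -
  obtain n ns' where ns: "ns = n # ns'" using len m by (cases ns) auto
  have "\<Phi> t ns \<le> E ns (\<lambda>ws. exp (t * opt_score S (rotate1 ws)))"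
    unfolding \<Phi>_def
  proof (intro E_mono)
    fix ws assume ws: "ws \<in> tuples ns"
    then obtain w ws' where w: "ws = w # ws'" using ns by (cases ws) (auto simp: mem_tuples)
    have "length (w # ws') = m" using ws w len by (simp add: mem_tuples)
    then have "opt_score S ws \<le> opt_score S (rotate1 ws)"
      unfolding w rotate1.simps using set_tuples[OF ws, unfolded w]
      by (intro opt_score_rotate1_ge[where A = A] S_sym) auto
    then show "exp (t * opt_score S ws) \<le> exp (t * opt_score S (rotate1 ws))"
      using t by (simp add: mult_left_mono)
  qed
  also have "\<dots> = \<Phi> t (rotate1 ns)"
    by (simp add: \<Phi>_def ns E_rotate1)
  finally show ?thesis .
qed

lemma \<Phi>_rotate:
  assumes "length ns = m" "0 \<le> t"
  shows "\<Phi> t ns \<le> \<Phi> t (rotate r ns)"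
proof (induction r)
  case (Suc r)
  then show ?case using \<Phi>_rotate1[of "rotate r ns" t] assms by (simp add: rotate_Suc)
qed simp

text \<open>The common lower bound \<open>c\<close> serves two uses: repeating one length vector,
  and running through its cyclic shifts.\<close>

lemma \<Phi>_power_le:
  assumes len: "\<And>i. length (v i) = m" and le: "\<And>i. c \<le> \<Phi> t (v i)" and c: "0 \<le> c" and t: "0 \<le> t"
  shows "c ^ r \<le> \<Phi> t (map (\<lambda>j. \<Sum>i<r. v i ! j) [0..<m])"
proof (induction r)
  case 0
  have "sum_list (map (\<lambda>j. \<Sum>i<0. v i ! j) [0..<m]) = (0::nat)" by simp
  then show ?case using \<Phi>_zero by simp
next
  case (Suc r)
  let ?u = "map (\<lambda>j. \<Sum>i<r. v i ! j) [0..<m]"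
  have "c ^ Suc r \<le> \<Phi> t ?u * \<Phi> t (v r)"
    unfolding power_Suc2 using Suc le c \<Phi>_pos[of t ?u] by (intro mult_mono) auto
  also have "\<dots> \<le> \<Phi> t (map2 (+) ?u (v r))"
    by (intro \<Phi>_add) (auto simp: len t)
  also have "map2 (+) ?u (v r) = map (\<lambda>j. \<Sum>i<Suc r. v i ! j) [0..<m]"
    by (rule nth_equalityI) (auto simp: len)
  finally show ?case .
qed

lemma \<Phi>_replicate_power_le:
  assumes "0 \<le> t"
  shows "\<Phi> t (replicate m N) ^ r \<le> \<Phi> t (replicate m (r * N))"
proof -
  have "map (\<lambda>j. \<Sum>i<r. replicate m N ! j) [0..<m] = replicate m (r * N)"
    by (rule nth_equalityI) auto
  with \<Phi>_power_le[of "\<lambda>_. replicate m N" "\<Phi> t (replicate m N)" t r] assms \<Phi>_pos[of t "replicate m N"]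
  show ?thesis by simp
qed

text \<open>Adding up the \<open>m\<close> cyclic shifts of the length vector makes all lengths equal.\<close>

lemma \<Phi>_power_le_balanced:
  assumes len: "length ns = m" and t: "0 \<le> t"
  shows "\<Phi> t ns ^ m \<le> \<Phi> t (replicate m (sum_list ns))"
proof -
  have "(\<Sum>i<m. rotate i ns ! j) = sum_list ns" if "j < m" for j
  proof -
    \<comment> \<open>Both entries are \<open>ns ! ((i + j) mod m)\<close>, so summing one position
      over all shifts is summing all positions of one shift.\<close>
    have "(\<Sum>i<m. rotate i ns ! j) = (\<Sum>i<m. rotate j ns ! i)"
      using that len by (intro sum.cong) (auto simp: nth_rotate add.commute)
    also have "\<dots> = sum_list (rotate j ns)"
      using len by (simp add: sum_list_sum_nth atLeast0LessThan)
    also have "\<dots> = sum_list ns"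
      using sum_list_append[of "take (j mod length ns) ns" "drop (j mod length ns) ns"]
      by (simp add: rotate_drop_take add.commute)
    finally show ?thesis .
  qed
  then have "map (\<lambda>j. \<Sum>i<m. rotate i ns ! j) [0..<m] = replicate m (sum_list ns)"
    by (intro nth_equalityI) auto
  with \<Phi>_power_le[of "\<lambda>i. rotate i ns" "\<Phi> t ns" t m] \<Phi>_rotate[OF len t] len t \<Phi>_pos[of t ns]
  show ?thesis by simp
qed

text \<open>When the cut lengths are fixed in advance, prefixes and suffixes are independent and the
  average factors.\<close>

lemma E_split:
  assumes len: "length ns = m" "length Ns = m" and le: "\<And>j. j < m \<Longrightarrow> ns ! j \<le> Ns ! j"
  shows "E Ns (\<lambda>ws. f (map2 take ns ws) * g (map2 drop ns ws)) = E ns f * E (map2 (-) Ns ns) g"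
proof -
  let ?Rs = "map2 (-) Ns ns"
  have Ns: "Ns = map2 (+) ns ?Rs" using len le by (intro nth_equalityI) auto
  have "E Ns (\<lambda>ws. f (map2 take ns ws) * g (map2 drop ns ws)) =
      E ns (\<lambda>us. E ?Rs (\<lambda>vs. f (map2 take ns (map2 (@) us vs)) * g (map2 drop ns (map2 (@) us vs))))"
    by (subst Ns, subst E_add) (use len in auto)
  also have "\<dots> = E ns (\<lambda>us. E ?Rs (\<lambda>vs. f us * g vs))"
  proof (intro E_cong)
    fix us vs assume uv: "us \<in> tuples ns" "vs \<in> tuples ?Rs"
    then have "map2 take ns (map2 (@) us vs) = us" "map2 drop ns (map2 (@) us vs) = vs"
      using len by (auto simp: mem_tuples intro!: nth_equalityI)
    then show "f (map2 take ns (map2 (@) us vs)) * g (map2 drop ns (map2 (@) us vs)) = f us * g vs"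
      by simp
  qed
  also have "\<dots> = E ns f * E ?Rs g"
    by (simp add: E_def wavg_cmult wavg_multc)
  finally show ?thesis .
qed

text \<open>Each induction step cuts off one piece of total length \<open>T\<close>. It costs a
  factor \<open>(T + 1) ^ m\<close> for the choice of the cut, \<open>exp (t * s)\<close> for the
  lost column and \<open>c\<close> for the piece itself.\<close>

lemma \<Phi>_le_power_pieces:
  assumes t: "0 \<le> t" and c: "\<And>ns. length ns = m \<Longrightarrow> sum_list ns = T \<Longrightarrow> \<Phi> t ns \<le> c"
  shows "length Ns = m \<Longrightarrow> sum_list Ns = k * T \<Longrightarrow> \<Phi> t Ns \<le> ((real T + 1) ^ m * exp (t * s) * c) ^ k"
proof (induction k arbitrary: Ns)
  case 0
  then show ?case by (simp add: \<Phi>_zero)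
next
  case (Suc k)
  let ?Q = "(real T + 1) ^ m * exp (t * s) * c"
  define C where "C = {ns. length ns = m \<and> sum_list ns = T \<and> (\<forall>j<m. ns ! j \<le> Ns ! j)}"
  \<comment> \<open>The vector \<open>(T, 0, ..., 0)\<close> shows that \<open>c\<close> bounds a
    positive number.\<close>
  have c0: "0 \<le> c"
  proof -
    have "sum_list (T # replicate (m - 1) 0) = T" by simp
    then have "\<Phi> t (T # replicate (m - 1) 0) \<le> c" using m by (intro c) auto
    with \<Phi>_pos show ?thesis by (meson less_imp_le less_le_trans)
  qed
  \<comment> \<open>Entries summing to \<open>T\<close> are each at most \<open>T\<close>, which
    limits the number of cuts.\<close>
  have Csub: "C \<subseteq> {ns. set ns \<subseteq> {..T} \<and> length ns = m}"
    by (auto simp: C_def dest: member_le_sum_list)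
  then have finC: "finite C" by (rule finite_subset) (intro finite_lists_length_eq, simp)
  have "card C \<le> card {ns. set ns \<subseteq> {..T} \<and> length ns = m}"
    using Csub by (intro card_mono finite_lists_length_eq) auto
  also have "\<dots> = Suc T ^ m" by (simp add: card_lists_length_eq)
  finally have "real (card C) \<le> real (Suc T ^ m)" by (rule of_nat_mono)
  then have cardC: "real (card C) \<le> (real T + 1) ^ m" by (simp add: add.commute)
  let ?f = "\<lambda>ws. exp (t * opt_score S ws)"
  \<comment> \<open>A good cut depends on \<open>ws\<close>. Summing the positive terms over all
    candidates dominates it, and each candidate is a fixed vector to which \<open>E_split\<close>
    applies.\<close>
  have "\<Phi> t Ns \<le> E Ns (\<lambda>ws. \<Sum>ns\<in>C. exp (t * s) * (?f (map2 take ns ws) * ?f (map2 drop ns ws)))"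
    unfolding \<Phi>_def
  proof (rule E_mono)
    fix ws assume ws: "ws \<in> tuples Ns"
    have len: "length ws = m" using ws Suc.prems by (simp add: mem_tuples)
    have "T \<le> sum_list (map length ws)" using map_length_tuples[OF ws] Suc.prems by simp
    moreover have "ws \<noteq> []" using len m by auto
    ultimately obtain ns where ns: "length ns = m" "\<And>j. j < m \<Longrightarrow> ns ! j \<le> length (ws ! j)"
      "sum_list ns = T" "opt_score S ws \<le> s + opt_score S (map2 take ns ws) + opt_score S (map2 drop ns ws)"
      using opt_score_cut[OF _ set_tuples[OF ws], of S s T] S_le s len by metis
    have nsC: "ns \<in> C" using ns ws Suc.prems by (auto simp: C_def mem_tuples)
    have "?f ws \<le> exp (t * (s + opt_score S (map2 take ns ws) + opt_score S (map2 drop ns ws)))"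
      using ns(4) t by (simp add: mult_left_mono)
    also have "\<dots> = exp (t * s) * (?f (map2 take ns ws) * ?f (map2 drop ns ws))"
      by (simp add: distrib_left exp_add)
    also have "\<dots> \<le> (\<Sum>ns\<in>C. exp (t * s) * (?f (map2 take ns ws) * ?f (map2 drop ns ws)))"
      by (rule member_le_sum[OF nsC _ finC]) simp
    finally show "?f ws \<le> \<dots>" .
  qed
  also have "\<dots> = (\<Sum>ns\<in>C. exp (t * s) * (\<Phi> t ns * \<Phi> t (map2 (-) Ns ns)))"
    unfolding E_def wavg_sum wavg_cmult unfolding E_def[symmetric] \<Phi>_def
    using Suc.prems by (intro sum.cong refl arg_cong2[where f = "(*)"] E_split) (auto simp: C_def)
  also have "\<dots> \<le> (\<Sum>ns\<in>C. exp (t * s) * (c * ?Q ^ k))"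
  proof (intro sum_mono mult_left_mono mult_mono)
    fix ns assume ns: "ns \<in> C"
    then show "\<Phi> t ns \<le> c" by (auto simp: C_def intro: c)
    have "sum_list Ns = sum_list ns + sum_list (map2 (-) Ns ns)"
      using ns Suc.prems
      by (simp add: C_def sum_list_sum_nth sum.distrib[symmetric])
    then have "sum_list (map2 (-) Ns ns) = k * T"
      using ns Suc.prems by (simp add: C_def)
    then show "\<Phi> t (map2 (-) Ns ns) \<le> ?Q ^ k"
      using ns Suc.prems by (intro Suc.IH) (auto simp: C_def)
  qed (use c0 \<Phi>_pos in \<open>auto intro: less_imp_le\<close>)
  also have "\<dots> = real (card C) * (exp (t * s) * (c * ?Q ^ k))" by simp
  also have "\<dots> \<le> (real T + 1) ^ m * (exp (t * s) * (c * ?Q ^ k))"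
    using c0 by (intro mult_right_mono cardC) auto
  also have "\<dots> = ?Q ^ Suc k" by simp
  finally show ?case .
qed

text \<open>One changed letter moves the score by at most \<open>D\<close>. Tensorizing first over
  the letters of a word and then over the words contributes \<open>t^2 * D^2\<close> for each of the
  \<open>sum_list ns\<close> letters.\<close>

lemma \<Phi>_le:
  assumes len: "length ns = m" and t: "0 \<le> t" "t * D \<le> 1"
  shows "\<Phi> t ns \<le> exp (t * E ns (opt_score S) + real (sum_list ns) * (t\<^sup>2 * D\<^sup>2))"
proof -
  let ?v = "t\<^sup>2 * D\<^sup>2"
  have w: "mgf_bound t D (prod_weight p) (listrel1 UNIV) (words n) (real n * ?v)" for n
  proof -
    have "list_all2 (\<lambda>B v. weights_on p B \<and> mgf_bound t D p UNIV B v) (replicate n A) (replicate n ?v)"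
      using mgf_bound_UNIV[OF p t] p by (auto simp: list_all2_conv_all_nth)
    from mgf_bound_listset[OF this] D show ?thesis
      by (simp add: words_def sum_list_replicate)
  qed
  have "mgf_bound t D (prod_weight (prod_weight p)) (listrel1 (listrel1 UNIV)) (tuples ns)
      (sum_list (map (\<lambda>n. real n * ?v) ns))"
    unfolding tuples_def using D w weights_words
    by (intro mgf_bound_listset) (auto simp: list_all2_conv_all_nth)
  moreover have "\<bar>opt_score S ws - opt_score S ws'\<bar> \<le> D"
    if "ws \<in> tuples ns" "ws' \<in> tuples ns" "(ws, ws') \<in> listrel1 (listrel1 UNIV)" for ws ws'
  proof -
    have "(ws', ws) \<in> listrel1 (listrel1 UNIV)"
      using that(3) by (metis converse_UNIV converse_iff listrel1_converse)
    moreover have "length ws = m" "length ws' = m" using that len by (auto simp: mem_tuples)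
    ultimately have "opt_score S ws \<le> opt_score S ws' + D" "opt_score S ws' \<le> opt_score S ws + D"
      using opt_score_change_letter[of ws ws' A D S] opt_score_change_letter[of ws' ws A D S]
        that set_tuples[OF that(1)] set_tuples[OF that(2)] D S_lip by simp_all
    then show ?thesis by linarith
  qed
  ultimately have "\<Phi> t ns \<le> exp (t * E ns (opt_score S) + sum_list (map (\<lambda>n. real n * ?v) ns))"
    unfolding mgf_bound_def \<Phi>_def E_def by blast
  then show ?thesis by (simp add: sum_list_mult_const sum_list_of_nat)
qed

section \<open>Rate of convergence of the mean score\<close>

text \<open>Pieces of total length \<open>n\<close>, \<open>m * N\<close> in number, exhaust
  \<open>m\<close> words of length \<open>n * N\<close>. Taking logarithms and dividing by
  \<open>t * N\<close> leaves a right side free of \<open>N\<close>, so that a supremum over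
  \<open>N\<close> can be taken.\<close>

lemma rate_inequality:
  assumes t: "0 < t" "t * D \<le> 1" and N: "1 \<le> N"
  shows "real n * (E (replicate m N) (opt_score S) / real N) \<le> E (replicate m n) (opt_score S)
      + (real m)\<^sup>2 * ln (real n + 1) / t + real m * s + real m * (real n * t * D\<^sup>2)"
proof -
  let ?e = "\<lambda>n. E (replicate m n) (opt_score S)"
  \<comment> \<open>\<open>exp V\<close> bounds the moment at equal lengths \<open>n\<close>, and
    balancing gives its \<open>m\<close>-th root for any vector of total \<open>n\<close>;
    \<open>W\<close> is the logarithmic cost of one piece.\<close>
  define V where "V = t * ?e n + real (m * n) * (t\<^sup>2 * D\<^sup>2)"
  define W where "W = real m * ln (real n + 1) + t * s + V / real m"
  have le: "\<Phi> t ns \<le> exp (V / real m)" if "length ns = m" "sum_list ns = n" for ns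
  proof (rule power_le_imp_le_base)
    have "\<Phi> t ns ^ m \<le> \<Phi> t (replicate m n)"
      using \<Phi>_power_le_balanced[OF that(1)] t that(2) by simp
    also have "\<dots> \<le> exp V"
      using \<Phi>_le[of "replicate m n" t] t by (simp add: V_def sum_list_replicate)
    also have "\<dots> = exp (V / real m) ^ Suc (m - 1)"
      using m by (simp add: exp_of_nat_mult[symmetric] del: power_Suc)
    finally show "\<Phi> t ns ^ Suc (m - 1) \<le> exp (V / real m) ^ Suc (m - 1)" using m by simp
  qed simp
  have "exp (real n * (t * ?e N)) = exp (t * ?e N) ^ n" by (rule exp_of_nat_mult)
  also have "\<dots> \<le> \<Phi> t (replicate m N) ^ n" by (intro power_mono exp_le_\<Phi>) simp
  also have "\<dots> \<le> \<Phi> t (replicate m (n * N))" using t by (intro \<Phi>_replicate_power_le) simp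
  also have "\<dots> \<le> ((real n + 1) ^ m * exp (t * s) * exp (V / real m)) ^ (m * N)"
    using t le by (intro \<Phi>_le_power_pieces) (auto simp: sum_list_replicate)
  also have "(real n + 1) ^ m * exp (t * s) * exp (V / real m) = exp W"
    by (simp add: W_def exp_add exp_of_nat_mult)
  also have "exp W ^ (m * N) = exp (real (m * N) * W)" by (rule exp_of_nat_mult[symmetric])
  finally have "real n * (t * ?e N) \<le> real (m * N) * W" by simp
  then have "real n * (?e N / real N) \<le> real m * W / t"
    using t N by (simp add: field_simps)
  also have "\<dots> = ?e n + (real m)\<^sup>2 * ln (real n + 1) / t + real m * s + real m * (real n * t * D\<^sup>2)"
    using t m by (simp add: W_def V_def field_simps power2_eq_square)
  finally show ?thesis .
qed

lemma rate:
  fixes n N :: nat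
  assumes n: "2 \<le> n" and N: "1 \<le> N"
  shows "real n * (E (replicate m N) (opt_score S) / real N) \<le> E (replicate m n) (opt_score S)
      + (2 * (real m)\<^sup>2 * D + real m * s + real m * D) * sqrt (real n * ln (real n))"
proof -
  define r where "r = sqrt (real n * ln (real n))"
  have n0: "0 < real n" using n by simp
  have "ln 2 \<le> ln (real n)" using n by simp
  then have ln: "1 / 2 \<le> ln (real n)" using ln2_ge_two_thirds by linarith
  have "1 \<le> real n * ln (real n)"
    using mult_mono[of 2 "real n" "1/2" "ln (real n)"] n ln by simp
  \<comment> \<open>This lets the constant \<open>m * s\<close> be absorbed into a multiple of
    \<open>r\<close>.\<close>
  then have r1: "1 \<le> r" by (simp add: r_def)
  have r2: "r * r = real n * ln (real n)" using ln by (simp add: r_def)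
  \<comment> \<open>This choice balances the errors: \<open>ln (n + 1) / t\<close> is at most
    \<open>2 * D * r\<close>, and \<open>n * t * D^2\<close> equals \<open>D * r\<close>.\<close>
  define t where "t = r / (real n * D)"
  have t0: "0 < t" using r1 n0 D by (simp add: t_def)
  \<comment> \<open>From \<open>ln n \<le> n - 1\<close> follows \<open>r \<le> n\<close>, hence
    \<open>t * D = r / n \<le> 1\<close>.\<close>
  have "r * r \<le> real n * real n" unfolding r2 using ln_le_minus_one[of "real n"] n0
    by (intro mult_left_mono) auto
  then have "r\<^sup>2 \<le> (real n)\<^sup>2" by (simp add: power2_eq_square)
  then have "r \<le> real n" by (rule power2_le_imp_le) simp
  then have tD: "t * D \<le> 1" using n0 D by (simp add: t_def field_simps)
  have "ln (real n + 1) \<le> ln (real n ^ 2)"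
  proof (rule ln_mono)
    have "real n + 1 \<le> 2 * real n" using n by simp
    also have "\<dots> \<le> real n * real n" using n by (intro mult_right_mono) auto
    finally show "real n + 1 \<le> real n ^ 2" by (simp add: power2_eq_square)
  qed (use n0 in auto)
  then have "ln (real n + 1) \<le> 2 * ln (real n)" using n0 by (simp add: ln_realpow)
  then have "ln (real n + 1) / t \<le> 2 * ln (real n) / t" using t0 by (intro divide_right_mono) auto
  also have "\<dots> = 2 * D * (real n * ln (real n)) / r" by (simp add: t_def)
  also have "\<dots> = 2 * D * r" using r1 by (simp add: r2[symmetric])
  finally have a: "(real m)\<^sup>2 * (ln (real n + 1) / t) \<le> (real m)\<^sup>2 * (2 * D * r)"
    by (intro mult_left_mono) auto
  have b: "real n * t * D\<^sup>2 = D * r"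
    using n0 D by (simp add: t_def power2_eq_square)
  have c: "real m * s * 1 \<le> real m * s * r" using r1 s by (intro mult_left_mono) auto
  show ?thesis
    using rate_inequality[OF t0 tD N, of n] a c unfolding b r_def[symmetric]
    by (simp add: algebra_simps)
qed

end

subsection \<open>Expectations over independent words\<close>

text \<open>The random tuple takes finitely many values, so \<open>f\<close> of it is a simple
  function; independence makes the probability of each value a product of letter
  probabilities.\<close>

lemma (in prob_space) expectation_iid_words:
  fixes X :: "nat \<Rightarrow> nat \<Rightarrow> 'a \<Rightarrow> real" and f :: "real list list \<Rightarrow> real"
  assumes A: "finite A" and n: "1 \<le> n" and m: "1 \<le> m"
    and meas: "\<And>i j. i \<ge> 1 \<Longrightarrow> j \<in> {1..m} \<Longrightarrow> X i j \<in> borel_measurable M"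
    and vals: "\<And>i j \<omega>. i \<ge> 1 \<Longrightarrow> j \<in> {1..m} \<Longrightarrow> \<omega> \<in> space M \<Longrightarrow> X i j \<omega> \<in> A"
    and indep: "indep_vars (\<lambda>_. borel) (\<lambda>(i, j). X i j) ({1..} \<times> {1..m})"
    and p: "\<And>i j a. i \<ge> 1 \<Longrightarrow> j \<in> {1..m} \<Longrightarrow> prob (X i j -` {a} \<inter> space M) = p a"
  shows "expectation (\<lambda>\<omega>. f (map (\<lambda>j. map (\<lambda>i. X i j \<omega>) [1..<n+1]) [1..<m+1])) =
    wavg (prod_weight (prod_weight p)) (listset (replicate m (listset (replicate n A)))) f"
proof -
  define W where "W \<omega> = map (\<lambda>j. map (\<lambda>i. X i j \<omega>) [1..<n+1]) [1..<m+1]" for \<omega>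
  let ?T = "listset (replicate m (listset (replicate n A)))"
  have T: "?T = {v. set v \<subseteq> {w. set w \<subseteq> A \<and> length w = n} \<and> length v = m}"
    by (auto simp: listset_replicate)
  have fin: "finite ?T" unfolding T by (intro finite_lists_length_eq A)
  have WT: "W \<omega> \<in> ?T" if "\<omega> \<in> space M" for \<omega>
    using vals that by (auto simp: T W_def)
  have ev: "{\<omega> \<in> space M. W \<omega> = v} \<in> events \<and> prob {\<omega> \<in> space M. W \<omega> = v} = prod_weight (prod_weight p) v"
    if v: "v \<in> ?T" for v
  proof -
    have len: "length v = m" "\<And>j. j < m \<Longrightarrow> length (v ! j) = n"
      using v by (auto simp: T dest: nth_mem)
    let ?I = "{1..n} \<times> {1..m}"
    let ?B = "\<lambda>(i, j). {v ! (j - 1) ! (i - 1)}"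
    \<comment> \<open>The variables are numbered from 1, list positions from 0.\<close>
    have nthW: "W \<omega> ! j ! i = X (Suc i) (Suc j) \<omega>" if "j < m" "i < n" for \<omega> i j
      using that by (simp add: W_def del: upt_Suc)
    have "W \<omega> = v \<longleftrightarrow> (\<forall>(i, j)\<in>?I. X i j \<omega> = v ! (j - 1) ! (i - 1))" for \<omega>
    proof
      assume W: "W \<omega> = v"
      show "\<forall>(i, j)\<in>?I. X i j \<omega> = v ! (j - 1) ! (i - 1)"
      proof clarify
        fix i j assume "i \<in> {1..n}" "j \<in> {1..m}"
        then show "X i j \<omega> = v ! (j - 1) ! (i - 1)"
          using nthW[of "j - 1" "i - 1" \<omega>] by (cases i; cases j) (simp_all add: W)
      qed
    next
      assume X: "\<forall>(i, j)\<in>?I. X i j \<omega> = v ! (j - 1) ! (i - 1)"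
      have "X (Suc i) (Suc j) \<omega> = v ! j ! i" if "j < m" "i < n" for i j
        using X that by (auto dest!: bspec[of _ _ "(Suc i, Suc j)"])
      then have "W \<omega> ! j ! i = v ! j ! i" if "j < m" "i < n" for i j
        using that nthW by simp
      moreover have "length (W \<omega>) = m" "\<And>j. j < m \<Longrightarrow> length (W \<omega> ! j) = n"
        by (simp_all add: W_def del: upt_Suc)
      ultimately show "W \<omega> = v" using len by (intro nth_equalityI) auto
    qed
    then have eq: "{\<omega> \<in> space M. W \<omega> = v} = (\<Inter>k\<in>?I. (\<lambda>(i, j). X i j) k -` ?B k \<inter> space M)"
      using n m by fastforce
    have "(\<lambda>(i, j). X i j) k -` ?B k \<inter> space M \<in> events" if "k \<in> ?I" for k
      using that meas by (auto intro!: measurable_sets[of _ M borel])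
    then have "{\<omega> \<in> space M. W \<omega> = v} \<in> events" (is ?ev)
      unfolding eq using n m by (intro sets.finite_INT) auto
    have "prob {\<omega> \<in> space M. W \<omega> = v} =
        (\<Prod>k\<in>?I. prob ((\<lambda>(i, j). X i j) k -` ?B k \<inter> space M))"
      unfolding eq using n m by (intro indep_varsD[OF indep]) auto
    also have "\<dots> = (\<Prod>(i, j)\<in>?I. p (v ! (j - 1) ! (i - 1)))"
      using p by (intro prod.cong) auto
    also have "\<dots> = (\<Prod>i\<in>{1..n}. \<Prod>j\<in>{1..m}. p (v ! (j - 1) ! (i - 1)))"
      by (rule prod.cartesian_product[symmetric])
    \<comment> \<open>Letters are regrouped word by word to match the nesting of
      \<open>prod_weight\<close>.\<close>
    also have "\<dots> = (\<Prod>j\<in>{1..m}. \<Prod>i\<in>{1..n}. p (v ! (j - 1) ! (i - 1)))"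
      by (rule prod.swap)
    also have "\<dots> = (\<Prod>j<m. \<Prod>i<n. p (v ! j ! i))"
      by (simp add: prod.atLeast1_atMost_eq)
    also have "\<dots> = prod_weight (prod_weight p) v"
      using len by (simp add: prod_weight_def prod.list_conv_set_nth atLeast0LessThan)
    finally show ?thesis using \<open>?ev\<close> by simp
  qed
  have "expectation (\<lambda>\<omega>. f (W \<omega>)) =
      expectation (\<lambda>\<omega>. \<Sum>v\<in>?T. f v * indicator {\<omega> \<in> space M. W \<omega> = v} \<omega>)"
  proof (rule Bochner_Integration.integral_cong)
    fix \<omega> assume \<omega>: "\<omega> \<in> space M"
    have "(\<Sum>v\<in>?T. f v * indicator {\<omega> \<in> space M. W \<omega> = v} \<omega>) = (\<Sum>v\<in>?T. if v = W \<omega> then f v else 0)"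
      using \<omega> by (intro sum.cong) (auto simp: indicator_def)
    also have "\<dots> = f (W \<omega>)" using fin WT[OF \<omega>] by simp
    finally show "f (W \<omega>) = (\<Sum>v\<in>?T. f v * indicator {\<omega> \<in> space M. W \<omega> = v} \<omega>)" ..
  qed simp
  also have "\<dots> = (\<Sum>v\<in>?T. expectation (\<lambda>\<omega>. f v * indicator {\<omega> \<in> space M. W \<omega> = v} \<omega>))"
    using ev by (intro Bochner_Integration.integral_sum integrable_mult_right integrable_real_indicator)
      (auto simp: emeasure_eq_measure)
  also have "\<dots> = (\<Sum>v\<in>?T. f v * prod_weight (prod_weight p) v)"
    using ev by (intro sum.cong) auto
  finally show ?thesis by (simp add: W_def wavg_def mult.commute)
qed

lemma (in prob_space) weights_on_distribution:
  assumes "finite A" "Y \<in> borel_measurable M" "\<And>\<omega>. \<omega> \<in> space M \<Longrightarrow> Y \<omega> \<in> A"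
  shows "weights_on (\<lambda>a::real. prob (Y -` {a} \<inter> space M)) A"
proof -
  have "(\<Sum>a\<in>A. prob (Y -` {a} \<inter> space M)) = prob (\<Union>a\<in>A. Y -` {a} \<inter> space M)"
    using assms by (intro finite_measure_finite_Union[symmetric])
      (auto simp: disjoint_family_on_def intro!: measurable_sets[of _ M borel])
  also have "(\<Union>a\<in>A. Y -` {a} \<inter> space M) = space M" using assms(3) by auto
  finally show ?thesis using assms(1) by (simp add: weights_on_def prob_space)
qed

theorem theorem2p1:
  fixes M :: "'w measure" and X :: "nat \<Rightarrow> nat \<Rightarrow> 'w \<Rightarrow> real"
    and A :: "real set" and S :: "real list \<Rightarrow> real" and m :: nat and D :: real
    and L :: "nat \<Rightarrow> 'w \<Rightarrow> real" and \<gamma> :: real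
  assumes "prob_space M"
    and "m \<ge> 2"
    and "finite A"
    and meas: "\<And>i j. i \<ge> 1 \<Longrightarrow> j \<in> {1..m} \<Longrightarrow> X i j \<in> borel_measurable M"
    and vals: "\<And>i j \<omega>. i \<ge> 1 \<Longrightarrow> j \<in> {1..m} \<Longrightarrow> \<omega> \<in> space M \<Longrightarrow> X i j \<omega> \<in> A"
    and indep: "prob_space.indep_vars M (\<lambda>_. borel) (\<lambda>(i, j). X i j) ({1..} \<times> {1..m})"
    and ident: "\<And>i j. i \<ge> 1 \<Longrightarrow> j \<in> {1..m} \<Longrightarrow> distr M borel (X i j) = distr M borel (X 1 1)"
    and S_nonneg: "\<And>x. length x = m \<Longrightarrow> set x \<subseteq> A \<Longrightarrow> S x \<ge> 0"
    and S_nonzero: "\<exists>x. length x = m \<and> set x \<subseteq> A \<and> S x \<noteq> 0"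
    and S_perm: "\<And>x y. length x = m \<Longrightarrow> set x \<subseteq> A \<Longrightarrow> mset y = mset x \<Longrightarrow> S y = S x"
    and S_bdd: "bdd_above (S ` {x. length x = m \<and> set x \<subseteq> A})"
    and "D > 0"
    and S_lip: "\<And>x y. length x = m \<Longrightarrow> set x \<subseteq> A \<Longrightarrow> length y = m \<Longrightarrow> set y \<subseteq> A \<Longrightarrow>
                  card {i. i < m \<and> x ! i \<noteq> y ! i} \<le> 1 \<Longrightarrow> \<bar>S x - S y\<bar> \<le> D"
    and L_def: "\<And>n \<omega>. L n \<omega> = opt_score S (map (\<lambda>j. map (\<lambda>i. X i j \<omega>) [1..<n+1]) [1..<m+1])"
    and \<gamma>_def: "\<gamma> = (SUP n\<in>{1::nat..}. prob_space.expectation M (L n) / real n)"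
  shows "\<exists>K > 0. \<forall>n::nat \<ge> 2.
           real n * \<gamma> - K * sqrt (real n * ln (real n)) \<le> prob_space.expectation M (L n)
           \<and> prob_space.expectation M (L n) \<le> real n * \<gamma>"
proof -
  interpret prob_space M by fact
  define p where "p a = prob (X 1 1 -` {a} \<inter> space M)" for a
  from S_bdd obtain B where B: "\<And>x. length x = m \<Longrightarrow> set x \<subseteq> A \<Longrightarrow> S x \<le> B"
    unfolding bdd_above_def by auto
  \<comment> \<open>The maximum with 0 supplies the sign condition on \<open>s\<close> in the
    locale.\<close>
  define s where "s = max 0 B"
  have law: "prob (X i j -` {a} \<inter> space M) = p a" if "i \<ge> 1" "j \<in> {1..m}" for i j a
  proof -
    have "prob (X i j -` {a} \<inter> space M) = measure (distr M borel (X i j)) {a}"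
      using meas[OF that] by (simp add: measure_distr)
    also have "\<dots> = measure (distr M borel (X 1 1)) {a}" by (simp add: ident[OF that])
    also have "\<dots> = p a" using meas[of 1 1] \<open>m \<ge> 2\<close> by (simp add: measure_distr p_def)
    finally show ?thesis .
  qed
  interpret alignment_model A p S m s D
  proof
    show "weights_on p A"
      unfolding p_def using \<open>m \<ge> 2\<close> by (intro weights_on_distribution \<open>finite A\<close> meas vals) auto
    show "S x \<le> s" if "length x = m" "set x \<subseteq> A" for x
      using B[OF that] by (simp add: s_def)
  qed (use \<open>m \<ge> 2\<close> \<open>D > 0\<close> in \<open>auto simp: s_def intro: S_perm S_lip\<close>)
  define e where "e n = expectation (L n)" for n
  have e: "e n = E (replicate m n) (opt_score S)" if "n \<ge> 1" for n
    unfolding e_def L_def E_def tuples_def words_def map_replicate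
    using that \<open>m \<ge> 2\<close> by (intro expectation_iid_words \<open>finite A\<close> meas vals indep law) auto
  define K where "K = 2 * (real m)\<^sup>2 * D + real m * s + real m * D"
  have "0 < real m * D" "0 \<le> real m * s" "0 \<le> 2 * (real m)\<^sup>2 * D"
    using \<open>m \<ge> 2\<close> \<open>D > 0\<close> by (auto simp: s_def)
  then have K: "0 < K" unfolding K_def by linarith
  have rate': "e N / real N \<le> (e n + K * sqrt (real n * ln (real n))) / real n"
    if "2 \<le> n" "1 \<le> N" for n N
    using rate[OF that] that by (simp add: e K_def pos_le_divide_eq mult.commute)
  \<comment> \<open>The case \<open>n = 2\<close> bounds all ratios at once, so the
    \<open>SUP\<close> defining \<open>\<gamma>\<close> is a true least upper bound.\<close>
  have bdd: "bdd_above ((\<lambda>n. e n / real n) ` {1..})"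
    by (intro bdd_aboveI2[where M = "(e 2 + K * sqrt (real 2 * ln (real 2))) / real 2"] rate') auto
  have "real n * \<gamma> - K * sqrt (real n * ln (real n)) \<le> e n \<and> e n \<le> real n * \<gamma>" if "2 \<le> n" for n
  proof
    \<comment> \<open>For fixed \<open>n\<close> the bound \<open>rate'\<close> holds for every
      \<open>N \<ge> 1\<close>, so it passes to the supremum.\<close>
    have "\<gamma> \<le> (e n + K * sqrt (real n * ln (real n))) / real n"
      unfolding \<gamma>_def e_def[symmetric] using rate'[OF that] by (intro cSUP_least) auto
    then show "real n * \<gamma> - K * sqrt (real n * ln (real n)) \<le> e n"
      using that by (simp add: pos_le_divide_eq mult.commute)
    have "e n / real n \<le> \<gamma>"
      unfolding \<gamma>_def e_def[symmetric] using that by (intro cSUP_upper bdd) auto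
    then show "e n \<le> real n * \<gamma>"
      using that by (simp add: pos_divide_le_eq mult.commute)
  qed
  with K show ?thesis unfolding e_def by blast
qed

end
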